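(* The linear homogeneous DODS $$\ddot y=a_1(x)\dot y+a_2(x)\dot y_-+a_3(x)y+a_4(x)y_-,\qquad x_-=g(x),$$ admits an infinite-dimensional Lie point symmetry algebra represented by the vector fields $$X(\rho)=\rho(x)\frac{\partial}{\partial y},\qquad Y=y\frac{\partial}{\partial y},$$ where $\rho(x)$ is the general solution of this same homogeneous linear DODS (i.e. $\rho$ ranges over all its solutions).
   Context: DODS = delay ordinary differential system. Notation: $y_-=y(x_-)$, $\dot y_-=\dot y(x_-)$. Standing assumptions: $a_i$ and $g$ are real functions smooth on some interval $x\in I$, $a_2^2+a_4^2\not\equiv0$, $g(x)<x$, $g\not\equiv\mathrm{const}$. Everything is local. Symmetry: a vector field $X=\xi(x,y)\partial_x+\eta(x,y)\partial_y$ is prolonged to $$\mathbf{pr}X=\xi\partial_x+\eta\partial_y+\xi^-\partial_{x_-}+\eta^-\partial_{y_-}+\zeta^1\partial_{\dot y}+\zeta^{1-}\partial_{\dot y_-}+\zeta^2\partial_{\ddot y},$$ with $\xi^-=\xi(x_-,y_-)$, $\eta^-=\eta(x_-,y_-)$, $\zeta^1=D(\eta)-\dot yD(\xi)$, $\zeta^{1-}=D_-(\eta^-)-\dot y_-D_-(\xi^-)$, $\zeta^2=D(\zeta^1)-\ddot yD(\xi)$, where $D$ and $D_-$ are the total derivative operators at $x$ and $x_-$. A system $\ddot y=f$, $x_-=g$ admits $X$ as a Lie point symmetry if $\mathbf{pr}X[\ddot y-f]=0$ and $\mathbf{pr}X[x_--g]=0$ whenever $\ddot y=f$ and $x_-=g$.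 *)

theory Defs
  imports "HOL-Analysis.Analysis" "HOL-Library.Function_Algebras"
begin

definition smooth1 :: "real set \<Rightarrow> (real \<Rightarrow> real) \<Rightarrow> bool" where
  "smooth1 U f \<longleftrightarrow> (\<forall>n. \<forall>x\<in>U. (deriv ^^ n) f differentiable (at x))"

definition pd1 :: "(real \<times> real \<Rightarrow> real) \<Rightarrow> real \<times> real \<Rightarrow> real" where
  "pd1 F = (\<lambda>(x, y). deriv (\<lambda>t. F (t, y)) x)"

definition pd2 :: "(real \<times> real \<Rightarrow> real) \<Rightarrow> real \<times> real \<Rightarrow> real" where
  "pd2 F = (\<lambda>(x, y). deriv (\<lambda>t. F (x, t)) y)"

text \<open>\<open>Ck2 k U F\<close>: on the open set \<open>U\<close> of the plane, all partial derivatives of \<open>F\<close>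
  up to order \<open>k\<close> exist and are continuous.\<close>

fun Ck2 :: "nat \<Rightarrow> (real \<times> real) set \<Rightarrow> (real \<times> real \<Rightarrow> real) \<Rightarrow> bool" where
  "Ck2 0 U F \<longleftrightarrow> continuous_on U F"
| "Ck2 (Suc k) U F \<longleftrightarrow> continuous_on U F \<and>
     (\<forall>(x, y)\<in>U. (\<lambda>t. F (t, y)) differentiable (at x) \<and> (\<lambda>t. F (x, t)) differentiable (at y)) \<and>
     Ck2 k U (pd1 F) \<and> Ck2 k U (pd2 F)"

definition smooth2 :: "(real \<times> real) set \<Rightarrow> (real \<times> real \<Rightarrow> real) \<Rightarrow> bool" where
  "smooth2 U F \<longleftrightarrow> (\<forall>k. Ck2 k U F)"

text \<open>\<open>V (x, y) = (\<xi>(x, y), \<eta>(x, y))\<close> stands for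
  \<open>\<xi>(x, y) \<partial>/\<partial>x + \<eta>(x, y) \<partial>/\<partial>y\<close>.\<close>

type_synonym vfield = "real \<times> real \<Rightarrow> real \<times> real"

definition vf_xi :: "vfield \<Rightarrow> real \<times> real \<Rightarrow> real" where
  "vf_xi V p = fst (V p)"

definition vf_eta :: "vfield \<Rightarrow> real \<times> real \<Rightarrow> real" where
  "vf_eta V p = snd (V p)"

definition smooth_vf :: "(real \<times> real) set \<Rightarrow> vfield \<Rightarrow> bool" where
  "smooth_vf U V \<longleftrightarrow> smooth2 U (vf_xi V) \<and> smooth2 U (vf_eta V)"

definition vf_scale :: "real \<Rightarrow> vfield \<Rightarrow> vfield" where
  "vf_scale c V = (\<lambda>p. c *\<^sub>R V p)"

interpretation vf: vector_space vf_scale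
  by unfold_locales (auto simp: vf_scale_def fun_eq_iff scaleR_add_right scaleR_add_left)

definition vf_apply :: "vfield \<Rightarrow> (real \<times> real \<Rightarrow> real) \<Rightarrow> real \<times> real \<Rightarrow> real" where
  "vf_apply V F p = vf_xi V p * pd1 F p + vf_eta V p * pd2 F p"

definition lie_bracket :: "vfield \<Rightarrow> vfield \<Rightarrow> vfield" where
  "lie_bracket V W = (\<lambda>p.
     (vf_apply V (vf_xi W) p - vf_apply W (vf_xi V) p,
      vf_apply V (vf_eta W) p - vf_apply W (vf_eta V) p))"

definition vf_lie_algebra :: "vfield set \<Rightarrow> bool" where
  "vf_lie_algebra L \<longleftrightarrow> vf.subspace L \<and> (\<forall>V\<in>L. \<forall>W\<in>L. lie_bracket V W \<in> L)"

text \<open>Vector fields are total functions, so their dimension has to be measured after forgetting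
  the irrelevant values outside the domain \<open>D\<close> on which they are considered.\<close>

definition vf_restrict :: "(real \<times> real) set \<Rightarrow> vfield \<Rightarrow> vfield" where
  "vf_restrict D V = (\<lambda>p. if p \<in> D then V p else 0)"

definition infinite_dimensional_on :: "(real \<times> real) set \<Rightarrow> vfield set \<Rightarrow> bool" where
  "infinite_dimensional_on D L \<longleftrightarrow> \<not> (\<exists>B. finite B \<and> vf_restrict D ` L \<subseteq> vf.span B)"

text \<open>Coordinates \<open>(x, y, x\<^sub>-, y\<^sub>-, y', y'\<^sub>-, y'')\<close>, where \<open>'\<close> is the derivative; the suffix
  \<open>m\<close> marks delayed quantities.\<close>

record jet =
  jx :: real
  jy :: real
  jxm :: real
  jym :: real
  jdy :: real
  jdym :: real
  jddy :: real

definition d_x :: "(jet \<Rightarrow> real) \<Rightarrow> jet \<Rightarrow> real" where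
  "d_x F z = deriv (\<lambda>t. F (z\<lparr>jx := t\<rparr>)) (jx z)"

definition d_y :: "(jet \<Rightarrow> real) \<Rightarrow> jet \<Rightarrow> real" where
  "d_y F z = deriv (\<lambda>t. F (z\<lparr>jy := t\<rparr>)) (jy z)"

definition d_xm :: "(jet \<Rightarrow> real) \<Rightarrow> jet \<Rightarrow> real" where
  "d_xm F z = deriv (\<lambda>t. F (z\<lparr>jxm := t\<rparr>)) (jxm z)"

definition d_ym :: "(jet \<Rightarrow> real) \<Rightarrow> jet \<Rightarrow> real" where
  "d_ym F z = deriv (\<lambda>t. F (z\<lparr>jym := t\<rparr>)) (jym z)"

definition d_dy :: "(jet \<Rightarrow> real) \<Rightarrow> jet \<Rightarrow> real" where
  "d_dy F z = deriv (\<lambda>t. F (z\<lparr>jdy := t\<rparr>)) (jdy z)"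

definition d_dym :: "(jet \<Rightarrow> real) \<Rightarrow> jet \<Rightarrow> real" where
  "d_dym F z = deriv (\<lambda>t. F (z\<lparr>jdym := t\<rparr>)) (jdym z)"

definition d_ddy :: "(jet \<Rightarrow> real) \<Rightarrow> jet \<Rightarrow> real" where
  "d_ddy F z = deriv (\<lambda>t. F (z\<lparr>jddy := t\<rparr>)) (jddy z)"

text \<open>The total derivatives are truncated: \<open>total_D\<close> is only applied to functions of
  \<open>(x, y, y')\<close> and \<open>total_Dm\<close> only to functions of \<open>(x\<^sub>-, y\<^sub>-)\<close>.\<close>

definition total_D :: "(jet \<Rightarrow> real) \<Rightarrow> jet \<Rightarrow> real" where
  "total_D F z = d_x F z + jdy z * d_y F z + jddy z * d_dy F z"

definition total_Dm :: "(jet \<Rightarrow> real) \<Rightarrow> jet \<Rightarrow> real" where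
  "total_Dm F z = d_xm F z + jdym z * d_ym F z"

definition pr_xi :: "vfield \<Rightarrow> jet \<Rightarrow> real" where
  "pr_xi V z = vf_xi V (jx z, jy z)"

definition pr_eta :: "vfield \<Rightarrow> jet \<Rightarrow> real" where
  "pr_eta V z = vf_eta V (jx z, jy z)"

definition pr_xim :: "vfield \<Rightarrow> jet \<Rightarrow> real" where
  "pr_xim V z = vf_xi V (jxm z, jym z)"

definition pr_etam :: "vfield \<Rightarrow> jet \<Rightarrow> real" where
  "pr_etam V z = vf_eta V (jxm z, jym z)"

definition zeta1 :: "vfield \<Rightarrow> jet \<Rightarrow> real" where
  "zeta1 V z = total_D (pr_eta V) z - jdy z * total_D (pr_xi V) z"

definition zeta1m :: "vfield \<Rightarrow> jet \<Rightarrow> real" where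
  "zeta1m V z = total_Dm (pr_etam V) z - jdym z * total_Dm (pr_xim V) z"

definition zeta2 :: "vfield \<Rightarrow> jet \<Rightarrow> real" where
  "zeta2 V z = total_D (zeta1 V) z - jddy z * total_D (pr_xi V) z"

definition prolong :: "vfield \<Rightarrow> (jet \<Rightarrow> real) \<Rightarrow> jet \<Rightarrow> real" where
  "prolong V F z =
     pr_xi V z * d_x F z + pr_eta V z * d_y F z +
     pr_xim V z * d_xm F z + pr_etam V z * d_ym F z +
     zeta1 V z * d_dy F z + zeta1m V z * d_dym F z + zeta2 V z * d_ddy F z"

text \<open>\<open>on_dods J f g z\<close>: the jet \<open>z\<close> satisfies the system \<open>y'' = f\<close>, \<open>x\<^sub>- = g\<close>, considered for
  \<open>x \<in> J\<close>.\<close>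

definition on_dods :: "real set \<Rightarrow> (jet \<Rightarrow> real) \<Rightarrow> (jet \<Rightarrow> real) \<Rightarrow> jet \<Rightarrow> bool" where
  "on_dods J f g z \<longleftrightarrow> jx z \<in> J \<and> jddy z = f z \<and> jxm z = g z"

definition dods_admits :: "real set \<Rightarrow> (jet \<Rightarrow> real) \<Rightarrow> (jet \<Rightarrow> real) \<Rightarrow> vfield \<Rightarrow> bool" where
  "dods_admits J f g V \<longleftrightarrow> (\<forall>z. on_dods J f g z \<longrightarrow>
     prolong V (\<lambda>z. jddy z - f z) z = 0 \<and> prolong V (\<lambda>z. jxm z - g z) z = 0)"

definition lie_point_symmetry :: "real set \<Rightarrow> (jet \<Rightarrow> real) \<Rightarrow> (jet \<Rightarrow> real) \<Rightarrow> vfield \<Rightarrow> bool" where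
  "lie_point_symmetry J f g V \<longleftrightarrow>
     (\<exists>U. open U \<and> (\<forall>z. on_dods J f g z \<longrightarrow> (jx z, jy z) \<in> U \<and> (jxm z, jym z) \<in> U) \<and>
          smooth_vf U V) \<and>
     dods_admits J f g V"

definition lin_rhs ::
  "(real \<Rightarrow> real) \<Rightarrow> (real \<Rightarrow> real) \<Rightarrow> (real \<Rightarrow> real) \<Rightarrow> (real \<Rightarrow> real) \<Rightarrow> jet \<Rightarrow> real" where
  "lin_rhs a1 a2 a3 a4 z =
     a1 (jx z) * jdy z + a2 (jx z) * jdym z + a3 (jx z) * jy z + a4 (jx z) * jym z"

definition lin_delay :: "(real \<Rightarrow> real) \<Rightarrow> jet \<Rightarrow> real" where
  "lin_delay g z = g (jx z)"

text \<open>The equation is imposed for \<open>x \<in> J\<close>, so the relevant values of a solution are those on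
  \<open>J \<union> g ` J\<close> (\<open>g ` J\<close> carries the initial data and need not lie in \<open>J\<close>).
  \<open>lin_solution\<close> asks only for the derivatives that occur in the system; the generators of the
  Lie algebra below, being smooth vector fields, come from smooth solutions.\<close>

definition lin_solution :: "real set \<Rightarrow> (real \<Rightarrow> real) \<Rightarrow> (real \<Rightarrow> real) \<Rightarrow> (real \<Rightarrow> real) \<Rightarrow>
    (real \<Rightarrow> real) \<Rightarrow> (real \<Rightarrow> real) \<Rightarrow> (real \<Rightarrow> real) \<Rightarrow> bool" where
  "lin_solution J a1 a2 a3 a4 g \<rho> \<longleftrightarrow> (\<forall>x\<in>J.
     \<rho> differentiable (at x) \<and> deriv \<rho> differentiable (at x) \<and> \<rho> differentiable (at (g x)) \<and>
     deriv (deriv \<rho>) x =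
       a1 x * deriv \<rho> x + a2 x * deriv \<rho> (g x) + a3 x * \<rho> x + a4 x * \<rho> (g x))"

definition lin_smooth_solution :: "real set \<Rightarrow> (real \<Rightarrow> real) \<Rightarrow> (real \<Rightarrow> real) \<Rightarrow> (real \<Rightarrow> real) \<Rightarrow>
    (real \<Rightarrow> real) \<Rightarrow> (real \<Rightarrow> real) \<Rightarrow> (real \<Rightarrow> real) \<Rightarrow> bool" where
  "lin_smooth_solution J a1 a2 a3 a4 g \<rho> \<longleftrightarrow> lin_solution J a1 a2 a3 a4 g \<rho> \<and>
     (\<exists>U. open U \<and> J \<union> g ` J \<subseteq> U \<and> smooth1 U \<rho>)"

definition vf_X :: "(real \<Rightarrow> real) \<Rightarrow> vfield" where
  "vf_X \<rho> = (\<lambda>(x, y). (0, \<rho> x))"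

definition vf_Y :: vfield where
  "vf_Y = (\<lambda>(x, y). (0, y))"

definition lin_algebra :: "real set \<Rightarrow> (real \<Rightarrow> real) \<Rightarrow> (real \<Rightarrow> real) \<Rightarrow> (real \<Rightarrow> real) \<Rightarrow>
    (real \<Rightarrow> real) \<Rightarrow> (real \<Rightarrow> real) \<Rightarrow> vfield set" where
  "lin_algebra J a1 a2 a3 a4 g =
     vf.span (insert vf_Y (vf_X ` {\<rho>. lin_smooth_solution J a1 a2 a3 a4 g \<rho>}))"

definition open_interval :: "real set \<Rightarrow> bool" where
  "open_interval J \<longleftrightarrow> open J \<and> is_interval J \<and> J \<noteq> {}"

end

theory Submission
  imports Defs "HOL-Computational_Algebra.Polynomial"
begin

text \<open>
  Every element of the algebra has the form \<open>(\<rho>(x) + c y) \<partial>/\<partial>y\<close> with \<open>\<rho>\<close> a smooth solution.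
  Its prolongation replaces \<open>y\<close> by \<open>\<rho> + c y\<close> in the linear equation, so the symmetry condition
  is linearity, and the bracket of two such fields is again of the form \<open>X(\<rho>)\<close>.

  For infinite dimension, work near \<open>x\<^sub>0\<close>: as \<open>g(x\<^sub>0) < x\<^sub>0\<close>, the image \<open>g(J)\<close> of a small interval
  \<open>J\<close> lies to the left of \<open>J\<close>. Prescribing \<open>\<rho>(t) = t\<^sup>k\<close> there turns the delay equation on \<open>J\<close>
  into an inhomogeneous linear ordinary differential equation, which is solvable. If \<open>g\<close> is not
  constant on \<open>J\<close>, then \<open>g(J)\<close> is infinite, and so the monomials \<open>t\<^sup>k\<close> are linearly independent
  on it.
\<close>

subsection \<open>Smooth functions of one variable\<close>

text \<open>Recursion peels off the innermost derivative, so closure properties of smooth functions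
  follow by induction on the order, with the function generalised.\<close>

fun times_diff :: "nat \<Rightarrow> real set \<Rightarrow> (real \<Rightarrow> real) \<Rightarrow> bool" where
  "times_diff 0 U f \<longleftrightarrow> True"
| "times_diff (Suc n) U f \<longleftrightarrow> (\<forall>x\<in>U. f differentiable (at x)) \<and> times_diff n U (deriv f)"

lemma times_diff_iff:
  "times_diff n U f \<longleftrightarrow> (\<forall>m<n. \<forall>x\<in>U. (deriv ^^ m) f differentiable (at x))"
proof (induction n arbitrary: f)
  case (Suc n)
  show ?case
    unfolding times_diff.simps Suc.IH All_less_Suc2 by (simp add: funpow_swap1)
qed simp

lemma smooth1_iff_times_diff: "smooth1 U f \<longleftrightarrow> (\<forall>n. times_diff n U f)"
  unfolding smooth1_def times_diff_iff by blast

lemma smooth1_differentiable: "smooth1 U f \<Longrightarrow> x \<in> U \<Longrightarrow> f differentiable (at x)"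
  unfolding smooth1_def by (drule spec[of _ 0]) simp

lemma smooth1_deriv: "smooth1 U f \<Longrightarrow> smooth1 U (deriv f)"
  unfolding smooth1_iff_times_diff using times_diff.simps(2) by blast

lemma smooth1_subset: "smooth1 U f \<Longrightarrow> V \<subseteq> U \<Longrightarrow> smooth1 V f"
  unfolding smooth1_def by blast

lemma smooth1_continuous_on: "smooth1 U f \<Longrightarrow> continuous_on U f"
  by (intro continuous_at_imp_continuous_on ballI differentiable_imp_continuous_within
      smooth1_differentiable)

lemma times_diff_SucD: "times_diff (Suc n) U f \<Longrightarrow> times_diff n U f"
  unfolding times_diff_iff by auto

lemma deriv_cong_open:
  assumes "open U" "x \<in> U" "\<And>y. y \<in> U \<Longrightarrow> f y = g y"
  shows "deriv f x = deriv g x"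
  using assms by (intro deriv_cong_ev) (auto simp: eventually_nhds)

lemma differentiable_cong_open:
  fixes f g :: "real \<Rightarrow> real"
  assumes "open U" "x \<in> U" "\<And>y. y \<in> U \<Longrightarrow> f y = g y" "f differentiable (at x)"
  shows "g differentiable (at x)"
proof -
  obtain D where "(f has_derivative D) (at x)"
    using assms(4) unfolding differentiable_def by blast
  then have "(g has_derivative D) (at x)"
    by (rule has_derivative_transform_within_open) (use assms in auto)
  then show ?thesis
    unfolding differentiable_def by blast
qed

text \<open>Formulas for \<open>deriv\<close> hold only at points of \<open>U\<close>, not as
  equations between total functions. On an open set agreement passes to all derivatives, so such
  formulas can still be substituted.\<close>

lemma times_diff_cong:
  assumes "open U" "\<And>x. x \<in> U \<Longrightarrow> f x = g x" "times_diff n U f"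
  shows "times_diff n U g"
  using assms(2,3)
proof (induction n arbitrary: f g)
  case (Suc n)
  have "times_diff n U (deriv g)"
  proof (rule Suc.IH)
    show "deriv f x = deriv g x" if "x \<in> U" for x
      using assms(1) that Suc.prems(1) by (rule deriv_cong_open)
  qed (use Suc.prems(2) in simp)
  moreover have "g differentiable (at x)" if "x \<in> U" for x
  proof (rule differentiable_cong_open)
    show "f differentiable (at x)" using Suc.prems(2) that by simp
  qed (use assms(1) that Suc.prems(1) in auto)
  ultimately show ?case by simp
qed simp

lemma smooth1_cong:
  "open U \<Longrightarrow> (\<And>x. x \<in> U \<Longrightarrow> f x = g x) \<Longrightarrow> smooth1 U f \<Longrightarrow> smooth1 U g"
  unfolding smooth1_iff_times_diff using times_diff_cong by blast

lemma smooth1_Un: "smooth1 U f \<Longrightarrow> smooth1 V f \<Longrightarrow> smooth1 (U \<union> V) f"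
  unfolding smooth1_def by blast

lemma deriv_add_real:
  fixes f g :: "real \<Rightarrow> real"
  assumes "f differentiable (at x)" "g differentiable (at x)"
  shows "deriv (\<lambda>x. f x + g x) x = deriv f x + deriv g x"
  using assms by (intro DERIV_imp_deriv derivative_intros)
    (simp_all add: DERIV_deriv_iff_real_differentiable)

lemma deriv_mult_real:
  fixes f g :: "real \<Rightarrow> real"
  assumes "f differentiable (at x)" "g differentiable (at x)"
  shows "deriv (\<lambda>x. f x * g x) x = f x * deriv g x + deriv f x * g x"
  using assms by (intro DERIV_imp_deriv DERIV_mult')
    (simp_all add: DERIV_deriv_iff_real_differentiable)

lemma deriv_cmult_real:
  fixes f :: "real \<Rightarrow> real"
  assumes "f differentiable (at x)"
  shows "deriv (\<lambda>x. c * f x) x = c * deriv f x"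
  using assms deriv_mult_real[of "\<lambda>_. c" x f] by simp

lemma times_diff_const: "times_diff n U (\<lambda>_. c)"
proof (induction n arbitrary: c)
  case (Suc n)
  have "deriv (\<lambda>_::real. c) = (\<lambda>_. 0)" by auto
  with Suc show ?case by simp
qed simp

lemma times_diff_add:
  assumes "open U" "times_diff n U f" "times_diff n U g"
  shows "times_diff n U (\<lambda>x. f x + g x)"
  using assms(2,3)
proof (induction n arbitrary: f g)
  case (Suc n)
  have "times_diff n U (\<lambda>x. deriv f x + deriv g x)"
    using Suc by simp
  then have "times_diff n U (deriv (\<lambda>x. f x + g x))"
    using Suc.prems by (elim times_diff_cong[OF assms(1), rotated]) (simp add: deriv_add_real)
  then show ?case using Suc.prems by simp
qed simp

lemma times_diff_mult:
  assumes "open U" "times_diff n U f" "times_diff n U g"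
  shows "times_diff n U (\<lambda>x. f x * g x)"
  using assms(2,3)
proof (induction n arbitrary: f g)
  case (Suc n)
  have "times_diff n U (\<lambda>x. f x * deriv g x + deriv f x * g x)"
    using Suc.prems Suc.prems[THEN times_diff_SucD]
    by (intro times_diff_add assms(1) Suc.IH) simp_all
  then have "times_diff n U (deriv (\<lambda>x. f x * g x))"
    using Suc.prems by (elim times_diff_cong[OF assms(1), rotated]) (simp add: deriv_mult_real)
  then show ?case using Suc.prems by simp
qed simp

lemma smooth1_const: "smooth1 U (\<lambda>_. c)"
  by (simp add: smooth1_iff_times_diff times_diff_const)

lemma smooth1_id: "smooth1 U (\<lambda>x. x)"
proof -
  have "deriv (\<lambda>x::real. x) = (\<lambda>_. 1)" by auto
  then have "times_diff n U (\<lambda>x. x)" for n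
    by (cases n) (simp_all add: times_diff_const)
  then show ?thesis by (simp add: smooth1_iff_times_diff)
qed

lemma smooth1_add:
  "open U \<Longrightarrow> smooth1 U f \<Longrightarrow> smooth1 U g \<Longrightarrow> smooth1 U (\<lambda>x. f x + g x)"
  by (simp add: smooth1_iff_times_diff times_diff_add)

lemma smooth1_mult:
  "open U \<Longrightarrow> smooth1 U f \<Longrightarrow> smooth1 U g \<Longrightarrow> smooth1 U (\<lambda>x. f x * g x)"
  by (simp add: smooth1_iff_times_diff times_diff_mult)

lemma smooth1_power: "open U \<Longrightarrow> smooth1 U f \<Longrightarrow> smooth1 U (\<lambda>x. f x ^ k)"
  by (induction k) (simp_all add: smooth1_const smooth1_mult)

text \<open>Bootstrapping: the equation writes the second derivative through \<open>u\<close>,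
  \<open>deriv u\<close> and smooth coefficients, so \<open>n\<close>-fold differentiability of
  \<open>u\<close> and \<open>deriv u\<close> improves to order \<open>n + 1\<close>.\<close>

lemma smooth1_linear_ode:
  assumes U: "open U" and coeff: "smooth1 U p" "smooth1 U q" "smooth1 U h"
    and diff: "\<And>x. x \<in> U \<Longrightarrow> u differentiable (at x)"
      "\<And>x. x \<in> U \<Longrightarrow> deriv u differentiable (at x)"
    and ode: "\<And>x. x \<in> U \<Longrightarrow> deriv (deriv u) x = p x * deriv u x + q x * u x + h x"
  shows "smooth1 U u"
proof -
  have "times_diff n U u \<and> times_diff n U (deriv u)" for n
  proof (induction n)
    case (Suc n)
    have "times_diff n U (\<lambda>x. p x * deriv u x + q x * u x + h x)"
      using Suc coeff U by (intro times_diff_add times_diff_mult) (auto simp: smooth1_iff_times_diff)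
    then have "times_diff n U (deriv (deriv u))"
      using ode by (elim times_diff_cong[OF U, rotated]) simp
    with Suc diff show ?case by simp
  qed simp
  then show ?thesis by (simp add: smooth1_iff_times_diff)
qed

subsection \<open>Linear second-order equations on short intervals\<close>

text \<open>Banach's fixed point theorem in the supremum metric. The source \<open>h\<close> cancels
  in differences, each integration contributes a factor \<open>b - a\<close>, and
  \<open>small\<close> says that the resulting Lipschitz constant is below 1. The admissible length
  therefore does not depend on \<open>h\<close>.\<close>

lemma linear_ode_exists:
  fixes p q h :: "real \<Rightarrow> real"
  assumes ab: "a < b"
    and cont: "continuous_on {a..b} p" "continuous_on {a..b} q" "continuous_on {a..b} h"
    and P: "\<And>x. x \<in> {a..b} \<Longrightarrow> \<bar>p x\<bar> \<le> P" and Q: "\<And>x. x \<in> {a..b} \<Longrightarrow> \<bar>q x\<bar> \<le> Q"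
    and small: "P * (b - a) + Q * (b - a)\<^sup>2 < 1"
  obtains u where "\<And>x. x \<in> {a<..<b} \<Longrightarrow> u differentiable (at x)"
    "\<And>x. x \<in> {a<..<b} \<Longrightarrow> deriv u differentiable (at x)"
    "\<And>x. x \<in> {a<..<b} \<Longrightarrow> deriv (deriv u) x = p x * deriv u x + q x * u x + h x"
proof -
  define c where "c x = max a (min b x)" for x
  have c: "c x \<in> {a..b}" "continuous_on UNIV c" "y \<in> {a..b} \<Longrightarrow> c y = y" for x y
    using ab unfolding c_def by (auto intro!: continuous_intros)
  define J where "J w x = integral {a..x} w" for w :: "real \<Rightarrow> real" and x
  have J_deriv: "(J w has_real_derivative w x) (at x within {a..b})"
    if "continuous_on {a..b} w" "x \<in> {a..b}" for w x
    using integral_has_real_derivative[OF that] unfolding J_def .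
  have J_cont: "continuous_on {a..b} (J w)" if "continuous_on {a..b} w" for w
    unfolding continuous_on_eq_continuous_within using J_deriv[OF that] DERIV_continuous by fast
  have J_bound: "\<bar>J w x - J w' x\<bar> \<le> d * (b - a)"
    if "continuous_on {a..b} w" "continuous_on {a..b} w'" "x \<in> {a..b}"
      "\<And>x. x \<in> {a..b} \<Longrightarrow> \<bar>w x - w' x\<bar> \<le> d" for w w' x d
  proof -
    have sub: "{a..x} \<subseteq> {a..b}" using that by auto
    have int: "w integrable_on {a..x}" "w' integrable_on {a..x}"
      using that(1,2) sub by (auto intro!: integrable_continuous_real elim: continuous_on_subset)
    have "J w x - J w' x = integral {a..x} (\<lambda>t. w t - w' t)"
      unfolding J_def using int by (simp add: integral_diff)
    also have "norm \<dots> \<le> d * (x - a)"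
      using that sub by (intro integral_bound) (auto intro!: continuous_intros elim: continuous_on_subset)
    also have "\<dots> \<le> d * (b - a)"
      using that(3) that(4)[of x] by (intro mult_left_mono) auto
    finally show ?thesis by simp
  qed
  \<comment> \<open>This is the right-hand side of the equation at \<open>u = J (J w)\<close>, where
    the first derivative of \<open>u\<close> is \<open>J w\<close>; a solution corresponds to
    \<open>w = G w\<close> on \<open>{a..b}\<close>.\<close>
  define G where "G w x = p x * J w x + q x * J (J w) x + h x" for w x
  have G_cont: "continuous_on {a..b} (G w)" if "continuous_on {a..b} w" for w
    unfolding G_def using cont that by (intro continuous_intros J_cont)
  have G_bcontfun: "(\<lambda>x. G w (c x)) \<in> bcontfun" if "continuous_on {a..b} w" for w
  unfolding bcontfun_def mem_Collect_eq
  proof (rule conjI)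
    show "continuous_on UNIV (\<lambda>x. G w (c x))"
      by (rule continuous_on_compose2[OF G_cont[OF that] c(2)]) (use c(1) in auto)
    have "bounded (G w ` {a..b})"
      by (intro compact_imp_bounded compact_continuous_image G_cont that) simp
    then show "bounded (range (\<lambda>x. G w (c x)))"
      by (rule bounded_subset) (use c(1) in auto)
  qed
  \<comment> \<open>The unknown is \<open>w = u''\<close> with zero data at \<open>a\<close>; the clamp \<open>c\<close> extends functions on
    \<open>{a..b}\<close> to the line, so that the complete space of bounded continuous functions applies.\<close>
  define T where "T w = Bcontfun (\<lambda>x. G (apply_bcontfun w) (c x))" for w :: "real \<Rightarrow>\<^sub>C real"
  have w_cont: "continuous_on S (apply_bcontfun w)" for w :: "real \<Rightarrow>\<^sub>C real" and S
    by (rule continuous_on_apply_bcontfun)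
  have T_apply: "apply_bcontfun (T w) x = G (apply_bcontfun w) (c x)" for w x
    unfolding T_def by (simp add: Bcontfun_inverse G_bcontfun w_cont)
  define \<kappa> where "\<kappa> = P * (b - a) + Q * (b - a)\<^sup>2"
  have PQ: "0 \<le> P" "0 \<le> Q" using P[of a] Q[of a] ab by auto
  have "dist (T w) (T w') \<le> \<kappa> * dist w w'" for w w'
  proof (rule dist_bound)
    fix x
    define d where "d = dist w w'"
    define y where "y = c x"
    have y: "y \<in> {a..b}" unfolding y_def by (rule c(1))
    have 0: "\<bar>apply_bcontfun w t - apply_bcontfun w' t\<bar> \<le> d" for t
      unfolding d_def using dist_bounded[of w t w'] by (simp add: dist_real_def)
    have 1: "\<bar>J w t - J w' t\<bar> \<le> d * (b - a)" if "t \<in> {a..b}" for t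
      using that 0 by (intro J_bound w_cont)
    have 2: "\<bar>J (J w) y - J (J w') y\<bar> \<le> (d * (b - a)) * (b - a)"
      by (rule J_bound[OF J_cont[OF w_cont] J_cont[OF w_cont] y 1])
    have "dist (apply_bcontfun (T w) x) (apply_bcontfun (T w') x)
        = \<bar>p y * (J w y - J w' y) + q y * (J (J w) y - J (J w') y)\<bar>"
      by (simp add: T_apply G_def dist_real_def y_def algebra_simps)
    also have "\<dots> \<le> \<bar>p y\<bar> * \<bar>J w y - J w' y\<bar> + \<bar>q y\<bar> * \<bar>J (J w) y - J (J w') y\<bar>"
      by (rule order_trans[OF abs_triangle_ineq]) (simp add: abs_mult)
    also have "\<dots> \<le> P * (d * (b - a)) + Q * ((d * (b - a)) * (b - a))"
      using P[OF y] Q[OF y] 1[OF y] 2 PQ by (intro add_mono mult_mono) auto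
    also have "\<dots> = \<kappa> * dist w w'"
      by (simp add: \<kappa>_def d_def power2_eq_square algebra_simps)
    finally show "dist (apply_bcontfun (T w) x) (apply_bcontfun (T w') x) \<le> \<kappa> * dist w w'" .
  qed
  then have "\<exists>!w. T w = w"
    using PQ ab small by (intro banach_fix_type[of \<kappa>]) (auto simp: \<kappa>_def)
  then obtain w where w: "T w = w" by auto
  have w_eq: "apply_bcontfun w x = G w x" if "x \<in> {a..b}" for x
    using T_apply[of w x] that by (simp add: w c(3))
  have at: "(J v has_real_derivative v x) (at x)" if "x \<in> {a<..<b}" "continuous_on {a..b} v" for v x
    using J_deriv[OF that(2), of x] that(1) at_within_Icc_at[of a x b] by auto
  let ?u = "J (J w)"
  have u1: "(?u has_real_derivative J w x) (at x)" if "x \<in> {a<..<b}" for x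
    using that by (intro at J_cont w_cont)
  then have d1: "deriv ?u x = J w x" if "x \<in> {a<..<b}" for x
    using that DERIV_imp_deriv by blast
  have u2: "(deriv ?u has_real_derivative apply_bcontfun w x) (at x)" if "x \<in> {a<..<b}" for x
    using at[OF that w_cont] open_greaterThanLessThan that
    by (rule has_field_derivative_transform_within_open) (simp add: d1)
  show ?thesis
  proof
    fix x assume x: "x \<in> {a<..<b}"
    show "?u differentiable (at x)" "deriv ?u differentiable (at x)"
      using u1[OF x] u2[OF x] unfolding real_differentiable_def by blast+
    show "deriv (deriv ?u) x = p x * deriv ?u x + q x * ?u x + h x"
      using DERIV_imp_deriv[OF u2[OF x]] w_eq[of x] x by (simp add: d1 G_def)
  qed
qed

subsection \<open>Symmetries affine in the dependent variable\<close>

text \<open>A common form for \<open>X(\<rho>)\<close>, \<open>Y\<close> and all their linear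
  combinations, so that the symmetry condition and the bracket are computed only once.\<close>

definition vf_affine :: "(real \<Rightarrow> real) \<Rightarrow> real \<Rightarrow> vfield" where
  "vf_affine \<rho> c = (\<lambda>(x, y). (0, \<rho> x + c * y))"

lemma vf_X_eq_affine: "vf_X \<rho> = vf_affine \<rho> 0"
  by (simp add: vf_X_def vf_affine_def)

lemma vf_Y_eq_affine: "vf_Y = vf_affine (\<lambda>_. 0) 1"
  by (simp add: vf_Y_def vf_affine_def)

lemma vf_xi_affine: "vf_xi (vf_affine \<rho> c) = (\<lambda>_. 0)"
  by (auto simp: vf_xi_def vf_affine_def)

lemma vf_eta_affine: "vf_eta (vf_affine \<rho> c) = (\<lambda>(x, y). \<rho> x + c * y)"
  by (auto simp: vf_eta_def vf_affine_def)

text \<open>Adding a constant does not change which numbers are derivatives at \<open>x\<close>, so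
  the equation holds even where \<open>f\<close> is not differentiable. This gives the prolongation
  formulas below for arbitrary \<open>\<rho>\<close>.\<close>

lemma deriv_add_const: "deriv (\<lambda>t. f t + c) x = deriv f x" for f :: "real \<Rightarrow> real"
proof -
  have "((\<lambda>t. f t + c) has_field_derivative D) (at x) \<longleftrightarrow> (f has_field_derivative D) (at x)" for D
    using DERIV_add[of "\<lambda>t. f t + c" D x UNIV "\<lambda>_. - c" 0] DERIV_add[of f D x UNIV "\<lambda>_. c" 0]
    by auto
  then show ?thesis by (simp add: deriv_def)
qed

lemma deriv_const_add: "deriv (\<lambda>t. c + f t) x = deriv f x" for f :: "real \<Rightarrow> real"
  using deriv_add_const[of f c x] by (simp add: add.commute)

lemma deriv_cmult_ident: "deriv (\<lambda>t. c * t) x = c" for c :: real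
  by (rule DERIV_imp_deriv) (auto intro!: derivative_eq_intros)

text \<open>The summand \<open>0 * y\<close> is kept on purpose: partial derivatives of an affine
  function then have the same affine shape, which lets the induction for
  \<open>smooth2_affine\<close> go through.\<close>

lemma pd1_affine: "pd1 (\<lambda>(x, y). r x + c * y) = (\<lambda>(x, y). deriv r x + 0 * y)"
  by (auto simp: pd1_def deriv_add_const)

lemma pd2_affine: "pd2 (\<lambda>(x, y). r x + c * y) = (\<lambda>(x, y). (\<lambda>_. c) x + 0 * y)"
  by (auto simp: pd2_def deriv_const_add deriv_cmult_ident)

lemma smooth2_affine:
  assumes "smooth1 U r"
  shows "smooth2 (U \<times> UNIV) (\<lambda>(x, y). r x + c * y)"
proof -
  have "Ck2 k (U \<times> UNIV) (\<lambda>(x, y). r x + c * y)" for k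
    using assms
  proof (induction k arbitrary: r c)
    case 0
    show ?case
      by (auto simp: case_prod_unfold intro!: continuous_intros
          continuous_on_compose2[OF smooth1_continuous_on[OF 0]])
  next
    case (Suc k)
    have "Ck2 k (U \<times> UNIV) (pd1 (\<lambda>(x, y). r x + c * y))"
      unfolding pd1_affine by (rule Suc.IH) (rule smooth1_deriv[OF Suc.prems])
    moreover have "Ck2 k (U \<times> UNIV) (pd2 (\<lambda>(x, y). r x + c * y))"
      unfolding pd2_affine by (rule Suc.IH) (rule smooth1_const)
    moreover have "continuous_on (U \<times> UNIV) (\<lambda>(x, y). r x + c * y)"
      by (auto simp: case_prod_unfold intro!: continuous_intros
          continuous_on_compose2[OF smooth1_continuous_on[OF Suc.prems]])
    ultimately show ?case
      using smooth1_differentiable[OF Suc.prems] by auto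
  qed
  then show ?thesis by (simp add: smooth2_def)
qed

lemma smooth_vf_affine: "smooth1 U \<rho> \<Longrightarrow> smooth_vf (U \<times> UNIV) (vf_affine \<rho> c)"
  using smooth2_affine[of U \<rho> c] smooth2_affine[OF smooth1_const, of U 0 0]
  by (simp add: smooth_vf_def vf_xi_affine vf_eta_affine case_prod_unfold)

section \<open>Prolongation of affine fields and the symmetry condition\<close>

lemma zeta1_affine: "zeta1 (vf_affine \<rho> c) z = deriv \<rho> (jx z) + c * jdy z"
  by (simp add: zeta1_def total_D_def d_x_def d_y_def d_dy_def pr_eta_def pr_xi_def vf_xi_affine
      vf_eta_affine deriv_add_const deriv_const_add deriv_cmult_ident)

lemma zeta1m_affine: "zeta1m (vf_affine \<rho> c) z = deriv \<rho> (jxm z) + c * jdym z"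
  by (simp add: zeta1m_def total_Dm_def d_xm_def d_ym_def pr_etam_def pr_xim_def vf_xi_affine
      vf_eta_affine deriv_add_const deriv_const_add deriv_cmult_ident)

lemma zeta2_affine: "zeta2 (vf_affine \<rho> c) z = deriv (deriv \<rho>) (jx z) + c * jddy z"
  by (simp add: zeta2_def zeta1_affine[abs_def] total_D_def d_x_def d_y_def d_dy_def pr_xi_def
      vf_xi_affine deriv_add_const deriv_const_add deriv_cmult_ident)

text \<open>As the \<open>\<partial>/\<partial>x\<close> component is zero, each coefficient is a
  total derivative of \<open>\<rho> + c y\<close>. No \<open>d_x\<close> or \<open>d_xm\<close> term
  survives, so derivatives of the coefficient functions and of \<open>g\<close> never enter.\<close>

lemma prolong_affine:
  "prolong (vf_affine \<rho> c) F z =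
     (\<rho> (jx z) + c * jy z) * d_y F z + (\<rho> (jxm z) + c * jym z) * d_ym F z +
     (deriv \<rho> (jx z) + c * jdy z) * d_dy F z + (deriv \<rho> (jxm z) + c * jdym z) * d_dym F z +
     (deriv (deriv \<rho>) (jx z) + c * jddy z) * d_ddy F z"
  by (simp add: prolong_def zeta1_affine zeta1m_affine zeta2_affine pr_xi_def pr_xim_def
      pr_eta_def pr_etam_def vf_xi_affine vf_eta_affine)

lemma partials_lin_rhs:
  fixes a1 a2 a3 a4 :: "real \<Rightarrow> real"
  defines "F \<equiv> \<lambda>z. jddy z - lin_rhs a1 a2 a3 a4 z"
  shows "d_y F z = - a3 (jx z)" "d_ym F z = - a4 (jx z)" "d_dy F z = - a1 (jx z)"
    "d_dym F z = - a2 (jx z)" "d_ddy F z = 1"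
  unfolding F_def d_y_def d_ym_def d_dy_def d_dym_def d_ddy_def lin_rhs_def
  by (rule DERIV_imp_deriv; auto intro!: derivative_eq_intros)+

lemma partials_lin_delay:
  fixes g :: "real \<Rightarrow> real"
  defines "F \<equiv> \<lambda>z. jxm z - lin_delay g z"
  shows "d_y F z = 0" "d_ym F z = 0" "d_dy F z = 0" "d_dym F z = 0" "d_ddy F z = 0"
  by (simp_all add: F_def d_y_def d_ym_def d_dy_def d_dym_def d_ddy_def lin_delay_def)

text \<open>On the system, the prolonged field turns the linear equation into the equation for
  \<open>\<rho>\<close> plus \<open>c\<close> times the equation for the jet, and both hold. The
  delay equation involves only \<open>x\<close> and \<open>x_-\<close>, in whose directions the
  field has no component.\<close>

lemma dods_admits_affine:
  assumes "lin_solution J a1 a2 a3 a4 g \<rho>"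
  shows "dods_admits J (lin_rhs a1 a2 a3 a4) (lin_delay g) (vf_affine \<rho> c)"
  unfolding dods_admits_def on_dods_def
proof (intro allI impI conjI)
  fix z assume z: "jx z \<in> J \<and> jddy z = lin_rhs a1 a2 a3 a4 z \<and> jxm z = lin_delay g z"
  then have "deriv (deriv \<rho>) (jx z) = a1 (jx z) * deriv \<rho> (jx z) + a2 (jx z) * deriv \<rho> (jxm z) +
      a3 (jx z) * \<rho> (jx z) + a4 (jx z) * \<rho> (jxm z)"
    using assms by (simp add: lin_solution_def lin_delay_def)
  with z show "prolong (vf_affine \<rho> c) (\<lambda>z. jddy z - lin_rhs a1 a2 a3 a4 z) z = 0"
    unfolding prolong_affine partials_lin_rhs by (simp add: lin_rhs_def algebra_simps)
  show "prolong (vf_affine \<rho> c) (\<lambda>z. jxm z - lin_delay g z) z = 0"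
    unfolding prolong_affine partials_lin_delay by simp
qed

lemma lie_point_symmetry_affine:
  assumes "lin_smooth_solution J a1 a2 a3 a4 g \<rho>"
  shows "lie_point_symmetry J (lin_rhs a1 a2 a3 a4) (lin_delay g) (vf_affine \<rho> c)"
proof -
  obtain U where U: "open U" "J \<union> g ` J \<subseteq> U" "smooth1 U \<rho>"
    using assms by (auto simp: lin_smooth_solution_def)
  have "open (U \<times> (UNIV :: real set))" using U(1) by (simp add: open_Times)
  moreover have "smooth_vf (U \<times> UNIV) (vf_affine \<rho> c)" by (rule smooth_vf_affine[OF U(3)])
  moreover have "dods_admits J (lin_rhs a1 a2 a3 a4) (lin_delay g) (vf_affine \<rho> c)"
    using assms by (intro dods_admits_affine) (simp add: lin_smooth_solution_def)
  ultimately show ?thesis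
    unfolding lie_point_symmetry_def on_dods_def lin_delay_def using U(2)
    by (intro conjI exI[of _ "U \<times> UNIV"]) auto
qed

section \<open>The space of smooth solutions and the Lie algebra built on it\<close>

lemma lin_smooth_solution_const_0: "lin_smooth_solution J a1 a2 a3 a4 g (\<lambda>_. 0)"
proof -
  have "deriv (\<lambda>_::real. 0::real) = (\<lambda>_. 0)" by auto
  then show ?thesis
    unfolding lin_smooth_solution_def lin_solution_def
    by (auto intro: exI[of _ UNIV] smooth1_const)
qed

text \<open>The two free coefficients cover sums (\<open>1\<close>, \<open>1\<close>), multiples
  (\<open>b\<close>, \<open>0\<close>) and the combination \<open>d\<close>, \<open>- c\<close>
  produced by the Lie bracket.\<close>

lemma lin_smooth_solution_combination:
  assumes J: "open J" and \<rho>: "lin_smooth_solution J a1 a2 a3 a4 g \<rho>"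
    and \<sigma>: "lin_smooth_solution J a1 a2 a3 a4 g \<sigma>"
  shows "lin_smooth_solution J a1 a2 a3 a4 g (\<lambda>x. b * \<rho> x + c * \<sigma> x)" (is "lin_smooth_solution _ _ _ _ _ _ ?\<tau>")
proof -
  obtain U V where U: "open U" "J \<union> g ` J \<subseteq> U" "smooth1 U \<rho>"
    and V: "open V" "J \<union> g ` J \<subseteq> V" "smooth1 V \<sigma>"
    using \<rho> \<sigma> by (auto simp: lin_smooth_solution_def)
  \<comment> \<open>The two solutions may be smooth on different neighbourhoods; the intersection is
    a common one.\<close>
  define W where "W = U \<inter> V"
  have W: "open W" "J \<union> g ` J \<subseteq> W" "smooth1 W \<rho>" "smooth1 W \<sigma>"
    using U V smooth1_subset[of _ _ W] by (auto simp: W_def)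
  have smooth: "smooth1 W ?\<tau>"
    using W by (intro smooth1_add smooth1_mult smooth1_const)
  have diff: "f differentiable (at x)" "deriv f differentiable (at x)"
    if "smooth1 W f" "x \<in> W" for f x
    using that smooth1_differentiable smooth1_deriv by blast+
  have 1: "deriv ?\<tau> x = b * deriv \<rho> x + c * deriv \<sigma> x" if "x \<in> W" for x
    using diff[OF W(3) that] diff[OF W(4) that] by (simp add: deriv_add_real deriv_cmult_real)
  have 2: "deriv (deriv ?\<tau>) x = b * deriv (deriv \<rho>) x + c * deriv (deriv \<sigma>) x" if "x \<in> W" for x
  proof -
    have "deriv (deriv ?\<tau>) x = deriv (\<lambda>x. b * deriv \<rho> x + c * deriv \<sigma> x) x"
      using W(1) that 1 by (rule deriv_cong_open)
    also have "\<dots> = b * deriv (deriv \<rho>) x + c * deriv (deriv \<sigma>) x"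
      using diff[OF W(3) that] diff[OF W(4) that] by (simp add: deriv_add_real deriv_cmult_real)
    finally show ?thesis .
  qed
  have "lin_solution J a1 a2 a3 a4 g ?\<tau>"
    unfolding lin_solution_def
  proof (intro ballI conjI)
    fix x assume x: "x \<in> J"
    then have xW: "x \<in> W" "g x \<in> W" using W(2) by auto
    show "?\<tau> differentiable (at x)" "deriv ?\<tau> differentiable (at x)" "?\<tau> differentiable (at (g x))"
      using diff[OF smooth] xW by blast+
    have "deriv (deriv \<rho>) x =
        a1 x * deriv \<rho> x + a2 x * deriv \<rho> (g x) + a3 x * \<rho> x + a4 x * \<rho> (g x)"
      "deriv (deriv \<sigma>) x =
        a1 x * deriv \<sigma> x + a2 x * deriv \<sigma> (g x) + a3 x * \<sigma> x + a4 x * \<sigma> (g x)"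
      using \<rho> \<sigma> x by (auto simp: lin_smooth_solution_def lin_solution_def)
    then show "deriv (deriv ?\<tau>) x =
        a1 x * deriv ?\<tau> x + a2 x * deriv ?\<tau> (g x) + a3 x * ?\<tau> x + a4 x * ?\<tau> (g x)"
      unfolding 1[OF xW(1)] 1[OF xW(2)] 2[OF xW(1)] by (simp add: algebra_simps)
  qed
  then show ?thesis
    unfolding lin_smooth_solution_def using W smooth by blast
qed

text \<open>The affine fields over smooth solutions form a subspace that contains all generators,
  hence also their span.\<close>

lemma lin_algebra_elim:
  assumes J: "open J" and "V \<in> lin_algebra J a1 a2 a3 a4 g"
  obtains \<rho> c where "V = vf_affine \<rho> c" "lin_smooth_solution J a1 a2 a3 a4 g \<rho>"
proof -
  let ?S = "{vf_affine \<rho> c | \<rho> c. lin_smooth_solution J a1 a2 a3 a4 g \<rho>}"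
  note comb = lin_smooth_solution_combination[OF J]
  have "vf.subspace ?S"
  proof (rule vf.subspaceI)
    show "0 \<in> ?S"
    proof -
      have "0 = vf_affine (\<lambda>_. 0) 0"
        by (auto simp: vf_affine_def fun_eq_iff zero_prod_def)
      then show ?thesis using lin_smooth_solution_const_0[of J a1 a2 a3 a4 g] by blast
    qed
  next
    fix V W assume "V \<in> ?S" "W \<in> ?S"
    then obtain \<rho> c \<sigma> d where VW: "V = vf_affine \<rho> c" "W = vf_affine \<sigma> d"
      and sol: "lin_smooth_solution J a1 a2 a3 a4 g \<rho>" "lin_smooth_solution J a1 a2 a3 a4 g \<sigma>"
      by blast
    have "V + W = vf_affine (\<lambda>x. 1 * \<rho> x + 1 * \<sigma> x) (c + d)"
      by (auto simp: VW vf_affine_def fun_eq_iff algebra_simps)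
    then show "V + W \<in> ?S" using comb[OF sol, of 1 1] by blast
  next
    fix b V assume "V \<in> ?S"
    then obtain \<rho> c where V: "V = vf_affine \<rho> c"
      and sol: "lin_smooth_solution J a1 a2 a3 a4 g \<rho>" by blast
    have "vf_scale b V = vf_affine (\<lambda>x. b * \<rho> x + 0 * \<rho> x) (b * c)"
      by (auto simp: V vf_scale_def vf_affine_def fun_eq_iff algebra_simps)
    then show "vf_scale b V \<in> ?S" using comb[OF sol sol, of b 0] by blast
  qed
  moreover have "insert vf_Y (vf_X ` {\<rho>. lin_smooth_solution J a1 a2 a3 a4 g \<rho>}) \<subseteq> ?S"
    using lin_smooth_solution_const_0[of J a1 a2 a3 a4 g]
    by (auto simp: vf_X_eq_affine vf_Y_eq_affine)
  ultimately have "lin_algebra J a1 a2 a3 a4 g \<subseteq> ?S"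
    unfolding lin_algebra_def by (intro vf.span_minimal)
  with assms(2) that show ?thesis by blast
qed

lemma vf_X_in_lin_algebra:
  "lin_smooth_solution J a1 a2 a3 a4 g \<rho> \<Longrightarrow> vf_X \<rho> \<in> lin_algebra J a1 a2 a3 a4 g"
  unfolding lin_algebra_def by (rule vf.span_base) simp

lemma pd_const_0: "pd1 (\<lambda>_. 0) = (\<lambda>_. 0)" "pd2 (\<lambda>_. 0) = (\<lambda>_. 0)"
  by (auto simp: pd1_def pd2_def)

text \<open>The terms \<open>c * d * y\<close> cancel in the commutator, leaving a function of
  \<open>x\<close> alone. Only derivatives in \<open>y\<close> contribute, so nothing is asked of
  \<open>\<rho>\<close> and \<open>\<sigma>\<close>.\<close>

lemma lie_bracket_affine:
  "lie_bracket (vf_affine \<rho> c) (vf_affine \<sigma> d) = vf_X (\<lambda>x. d * \<rho> x + (- c) * \<sigma> x)"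
  unfolding lie_bracket_def vf_apply_def vf_xi_affine vf_eta_affine pd_const_0 pd2_affine
  by (auto simp: vf_X_def fun_eq_iff algebra_simps)

lemma vf_lie_algebra_lin_algebra:
  assumes "open J"
  shows "vf_lie_algebra (lin_algebra J a1 a2 a3 a4 g)"
  unfolding vf_lie_algebra_def
proof (intro conjI ballI)
  show "vf.subspace (lin_algebra J a1 a2 a3 a4 g)"
    unfolding lin_algebra_def by (rule vf.subspace_span)
  fix V W assume VW: "V \<in> lin_algebra J a1 a2 a3 a4 g" "W \<in> lin_algebra J a1 a2 a3 a4 g"
  obtain \<rho> c where V: "V = vf_affine \<rho> c" "lin_smooth_solution J a1 a2 a3 a4 g \<rho>"
    using assms VW(1) by (rule lin_algebra_elim)
  obtain \<sigma> d where W: "W = vf_affine \<sigma> d" "lin_smooth_solution J a1 a2 a3 a4 g \<sigma>"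
    using assms VW(2) by (rule lin_algebra_elim)
  show "lie_bracket V W \<in> lin_algebra J a1 a2 a3 a4 g"
    unfolding V(1) W(1) lie_bracket_affine
    by (intro vf_X_in_lin_algebra lin_smooth_solution_combination assms V(2) W(2))
qed

subsection \<open>Infinite dimension\<close>

text \<open>It suffices to look along one horizontal line: a linear relation among the fields gives
  a polynomial vanishing on the infinite set \<open>S\<close>, hence the zero polynomial. An
  infinite independent family cannot lie in the span of a finite set.\<close>

lemma infinite_dimensional_onI:
  fixes v :: "nat \<Rightarrow> vfield"
  assumes v: "\<And>k. v k \<in> L" and inf: "infinite S" and SD: "S \<times> {y} \<subseteq> D"
    and monomial: "\<And>k s. s \<in> S \<Longrightarrow> v k (s, y) = (0, s ^ k)"
  shows "infinite_dimensional_on D L"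
  unfolding infinite_dimensional_on_def
proof
  assume "\<exists>B. finite B \<and> vf_restrict D ` L \<subseteq> vf.span B"
  then obtain B where B: "finite B" "vf_restrict D ` L \<subseteq> vf.span B" by blast
  define w where "w k = vf_restrict D (v k)" for k
  have w: "w k (s, y) = (0, s ^ k)" if "s \<in> S" for k s
    using that SD monomial by (auto simp: w_def vf_restrict_def)
  have zero: "c k = 0" if T: "finite T" "k \<in> T" and sum: "(\<Sum>j\<in>T. vf_scale (c j) (w j)) = 0"
    for c and T :: "nat set" and k
  proof -
    define p where "p = (\<Sum>j\<in>T. monom (c j) j)"
    have "poly p s = 0" if "s \<in> S" for s
    proof -
      have "(\<Sum>j\<in>T. vf_scale (c j) (w j)) (s, y) = (\<Sum>j\<in>T. vf_scale (c j) (w j) (s, y))"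
        by (induction T rule: infinite_finite_induct) simp_all
      then have "snd (\<Sum>j\<in>T. vf_scale (c j) (w j) (s, y)) = 0"
        using sum by simp
      then show ?thesis
        by (simp add: p_def poly_sum poly_monom snd_sum vf_scale_def w[OF that])
    qed
    then have "S \<subseteq> {s. poly p s = 0}" by blast
    then have "p = 0"
      using inf poly_roots_finite finite_subset by blast
    then have "coeff p k = 0" by simp
    with T show ?thesis by (simp add: p_def coeff_sum)
  qed
  \<comment> \<open>Independence concerns the set \<open>range w\<close>, so repetitions must be
    excluded first; a coincidence would be a relation with coefficients \<open>1\<close> and
    \<open>- 1\<close>.\<close>
  have inj: "inj w"
  proof (rule injI, rule ccontr)
    fix i j assume ij: "w i = w j" "i \<noteq> j"
    have "(\<Sum>l\<in>{i, j}. vf_scale (if l = i then 1 else - 1) (w l)) = 0"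
      using ij by (simp add: vf_scale_def fun_eq_iff)
    from zero[OF _ _ this, of i] show False by simp
  qed
  have "vf.independent (range w)"
    unfolding vf.independent_explicit_module
  proof (intro allI impI)
    fix t u x assume t: "finite t" "t \<subseteq> range w" "(\<Sum>x\<in>t. vf_scale (u x) x) = 0" "x \<in> t"
    define T where "T = w -` t"
    have tT: "t = w ` T" using t(2) by (auto simp: T_def)
    have "finite T" unfolding T_def using t(1) inj by (rule finite_vimageI)
    moreover obtain k where k: "k \<in> T" "x = w k" using t(4) tT by blast
    moreover have "(\<Sum>j\<in>T. vf_scale (u (w j)) (w j)) = 0"
      using t(3) unfolding tT by (subst (asm) sum.reindex) (auto intro: inj_on_subset[OF inj])
    ultimately show "u x = 0" using zero[of T k "\<lambda>j. u (w j)"] by simp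
  qed
  moreover have "range w \<subseteq> vf.span B" using B(2) v by (auto simp: w_def)
  ultimately have "finite (range w)" using vf.independent_span_bound[OF B(1)] by blast
  then show False using inj finite_imageD infinite_UNIV_nat by blast
qed

section \<open>Local solutions with monomial initial data\<close>

lemma open_interval_connected: "open_interval J \<Longrightarrow> connected J"
  by (simp add: open_interval_def is_interval_connected_1)

lemma infinite_image_connected:
  fixes g :: "real \<Rightarrow> real"
  assumes "connected J" "continuous_on J g" "\<not> g constant_on J"
  shows "infinite (g ` J)"
proof
  assume "finite (g ` J)"
  moreover have "connected (g ` J)"
    using assms(2,1) by (rule connected_continuous_image)
  ultimately have "g ` J = {} \<or> (\<exists>c. g ` J = {c})"
    using connected_finite_iff_sing by blast
  with assms(3) show False
    unfolding constant_on_def by blast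
qed

text \<open>One step of the method of steps: to the left of \<open>a\<close> the solution is
  prescribed, which makes the delayed terms on \<open>J\<close> a known source in an ordinary
  equation.\<close>

lemma local_monomial_solution:
  assumes coeff: "smooth1 {m<..<M} a1" "smooth1 {m<..<M} a2" "smooth1 {m<..<M} a3"
      "smooth1 {m<..<M} a4" "smooth1 {m<..<M} g"
    and ab: "m < a" "a < b" "b < M"
    and bound: "\<And>x. x \<in> {a..b} \<Longrightarrow> \<bar>a1 x\<bar> \<le> P" "\<And>x. x \<in> {a..b} \<Longrightarrow> \<bar>a3 x\<bar> \<le> Q"
    and small: "P * (b - a) + Q * (b - a)\<^sup>2 < 1"
    and J: "J \<subseteq> {a<..<b}" and gJ: "g ` J \<subseteq> {..<a}"
  obtains \<rho> where "lin_smooth_solution J a1 a2 a3 a4 g \<rho>" "\<And>t. t < a \<Longrightarrow> \<rho> t = t ^ k"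
proof -
  \<comment> \<open>These are the delayed terms for \<open>\<rho> t = t ^ k\<close>. For
    \<open>k = 0\<close> the factor \<open>real k\<close> removes the term with the truncated
    exponent \<open>k - 1\<close>.\<close>
  define h where "h x = a2 x * (real k * g x ^ (k - 1)) + a4 x * g x ^ k" for x
  let ?B = "{a<..<b}" and ?W = "{..<a}"
  have h: "smooth1 {m<..<M} h"
    unfolding h_def using coeff
    by (intro smooth1_add smooth1_mult smooth1_power smooth1_const) auto
  have cont: "continuous_on {a..b} f" if "smooth1 {m<..<M} f" for f
    by (rule continuous_on_subset[OF smooth1_continuous_on[OF that]]) (use ab in auto)
  have sub: "smooth1 ?B f" if "smooth1 {m<..<M} f" for f
    by (rule smooth1_subset[OF that]) (use ab in auto)
  obtain u where u: "\<And>x. x \<in> ?B \<Longrightarrow> u differentiable (at x)"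
    "\<And>x. x \<in> ?B \<Longrightarrow> deriv u differentiable (at x)"
    "\<And>x. x \<in> ?B \<Longrightarrow> deriv (deriv u) x = a1 x * deriv u x + a3 x * u x + h x"
    using linear_ode_exists[OF ab(2) cont[OF coeff(1)] cont[OF coeff(3)] cont[OF h] bound small]
    by blast
  have u_smooth: "smooth1 ?B u"
    using sub[OF coeff(1)] sub[OF coeff(3)] sub[OF h] u
    by (rule smooth1_linear_ode[OF open_greaterThanLessThan])
  \<comment> \<open>The branches are used on the disjoint open sets \<open>?W\<close> and
    \<open>?B\<close>. The point \<open>a\<close> lies in neither, so no matching of
    \<open>u\<close> with \<open>t ^ k\<close> arises there.\<close>
  define \<rho> where "\<rho> x = (if x < a then x ^ k else u x)" for x
  have \<rho>W: "t ^ k = \<rho> t" if "t \<in> ?W" for t using that by (simp add: \<rho>_def)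
  have \<rho>B: "u t = \<rho> t" if "t \<in> ?B" for t using that by (simp add: \<rho>_def)
  have "smooth1 ?W \<rho>"
    by (rule smooth1_cong[OF _ \<rho>W]) (auto intro: smooth1_power smooth1_id)
  moreover have "smooth1 ?B \<rho>"
    by (rule smooth1_cong[OF _ \<rho>B]) (auto intro: u_smooth)
  ultimately have smooth: "smooth1 (?W \<union> ?B) \<rho>" by (rule smooth1_Un)
  have dW: "deriv \<rho> t = real k * t ^ (k - 1)" if "t \<in> ?W" for t
  proof -
    have "deriv (\<lambda>t. t ^ k) t = deriv \<rho> t"
      using open_lessThan that \<rho>W by (rule deriv_cong_open)
    moreover have "deriv (\<lambda>t. t ^ k) t = real k * t ^ (k - 1)"
      by (rule DERIV_imp_deriv) (auto intro!: derivative_eq_intros)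
    ultimately show ?thesis by simp
  qed
  have dB: "deriv u t = deriv \<rho> t" if "t \<in> ?B" for t
    using open_greaterThanLessThan that \<rho>B by (rule deriv_cong_open)
  have ddB: "deriv (deriv u) t = deriv (deriv \<rho>) t" if "t \<in> ?B" for t
    using open_greaterThanLessThan that dB by (rule deriv_cong_open)
  have "lin_solution J a1 a2 a3 a4 g \<rho>"
    unfolding lin_solution_def
  proof (intro ballI conjI)
    fix x assume "x \<in> J"
    then have x: "x \<in> ?B" "g x \<in> ?W" using J gJ by auto
    show "\<rho> differentiable (at x)" "\<rho> differentiable (at (g x))"
      using smooth1_differentiable[OF smooth] x by blast+
    show "deriv \<rho> differentiable (at x)"
      using smooth1_differentiable[OF smooth1_deriv[OF smooth]] x by blast
    show "deriv (deriv \<rho>) x =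
        a1 x * deriv \<rho> x + a2 x * deriv \<rho> (g x) + a3 x * \<rho> x + a4 x * \<rho> (g x)"
      using u(3)[OF x(1)]
      by (simp add: dB[OF x(1)] ddB[OF x(1)] \<rho>B[OF x(1)] dW[OF x(2)] \<rho>W[OF x(2), symmetric] h_def)
  qed
  moreover have "J \<union> g ` J \<subseteq> ?W \<union> ?B" using J gJ by auto
  ultimately have "lin_smooth_solution J a1 a2 a3 a4 g \<rho>"
    unfolding lin_smooth_solution_def using smooth by (metis open_Un open_greaterThanLessThan open_lessThan)
  then show ?thesis using that \<rho>W by auto
qed

text \<open>A single \<open>\<epsilon>\<close> serves every exponent \<open>k\<close>, because the
  length condition for solving the equation bounds only \<open>a1\<close> and \<open>a3\<close>,
  while \<open>k\<close> enters through the source.\<close>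

lemma infinite_dimensional_near_point:
  assumes I: "open_interval I"
    and smooth: "smooth1 I a1" "smooth1 I a2" "smooth1 I a3" "smooth1 I a4" "smooth1 I g"
    and x0: "x0 \<in> I" "g x0 < x0"
  shows "\<exists>\<epsilon>>0. \<forall>J. open_interval J \<and> J \<subseteq> I \<inter> ball x0 \<epsilon> \<and> \<not> g constant_on J \<longrightarrow>
      infinite_dimensional_on ((J \<union> g ` J) \<times> UNIV) (lin_algebra J a1 a2 a3 a4 g)"
proof -
  obtain r where r: "r > 0" "cball x0 r \<subseteq> I"
    using I x0(1) by (auto simp: open_interval_def open_contains_cball)
  have bnd: "\<exists>P. \<forall>x\<in>cball x0 r. \<bar>f x\<bar> \<le> P" if "smooth1 I f" for f
  proof -
    have "compact (f ` cball x0 r)"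
      using continuous_on_subset[OF smooth1_continuous_on[OF that] r(2)]
      by (intro compact_continuous_image) auto
    then show ?thesis
      using compact_imp_bounded by (fastforce simp: bounded_iff)
  qed
  obtain P Q where PQ: "\<And>x. x \<in> cball x0 r \<Longrightarrow> \<bar>a1 x\<bar> \<le> P" "\<And>x. x \<in> cball x0 r \<Longrightarrow> \<bar>a3 x\<bar> \<le> Q"
    using bnd[OF smooth(1)] bnd[OF smooth(3)] by blast
  have pos: "P \<ge> 0" "Q \<ge> 0" using PQ[of x0] r(1) by auto
  \<comment> \<open>Half the delay at \<open>x0\<close>: if \<open>g x\<close> stays within
    \<open>\<delta>\<close> of \<open>g x0\<close>, it stays below
    \<open>x0 - \<delta>\<close>.\<close>
  define \<delta> where "\<delta> = (x0 - g x0) / 2"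
  have \<delta>: "\<delta> > 0" using x0(2) by (simp add: \<delta>_def)
  have "isCont g x0"
    using smooth1_differentiable[OF smooth(5) x0(1)] differentiable_imp_continuous_within by blast
  then obtain s where s: "s > 0" "\<And>x. dist x x0 < s \<Longrightarrow> dist (g x) (g x0) < \<delta>"
    using \<delta> unfolding continuous_at_eps_delta by blast
  \<comment> \<open>\<open>r / 2\<close> keeps the closed interval where the coefficients are smooth
    and bounded; \<open>\<delta>\<close> and \<open>s\<close> keep the image under \<open>g\<close>
    to its left; the last two entries give \<open>2 * \<epsilon> \<le> 1\<close> and a contraction
    constant below 1.\<close>
  define \<epsilon> where "\<epsilon> = Min {r / 2, \<delta>, s, 1 / 2, 1 / (4 * (P + Q + 1))}"
  have "\<epsilon> > 0" using r(1) \<delta> s(1) pos by (simp add: \<epsilon>_def)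
  moreover have "\<epsilon> \<le> r / 2" "\<epsilon> \<le> \<delta>" "\<epsilon> \<le> s" "\<epsilon> \<le> 1 / 2" "\<epsilon> \<le> 1 / (4 * (P + Q + 1))"
    unfolding \<epsilon>_def by (rule Min_le; simp)+
  ultimately have \<epsilon>: "\<epsilon> > 0" "\<epsilon> \<le> r / 2" "\<epsilon> \<le> \<delta>" "\<epsilon> \<le> s" "\<epsilon> \<le> 1 / 2"
    "\<epsilon> \<le> 1 / (4 * (P + Q + 1))" .
  have small: "P * (2 * \<epsilon>) + Q * (2 * \<epsilon>)\<^sup>2 < 1"
  proof -
    have "(2 * \<epsilon>)\<^sup>2 \<le> 2 * \<epsilon>"
      using \<epsilon> by (simp add: power2_eq_square)
    then have "P * (2 * \<epsilon>) + Q * (2 * \<epsilon>)\<^sup>2 \<le> P * (2 * \<epsilon>) + Q * (2 * \<epsilon>)"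
      using pos by (intro add_mono mult_left_mono) auto
    also have "\<dots> = 2 * (P + Q) * \<epsilon>" by (simp add: algebra_simps)
    also have "\<dots> \<le> 2 * (P + Q) * (1 / (4 * (P + Q + 1)))"
      using pos \<epsilon> by (intro mult_left_mono) auto
    also have "\<dots> < 1" using pos by (simp add: field_simps)
    finally show ?thesis .
  qed
  show ?thesis
  proof (intro exI conjI allI impI)
    show "\<epsilon> > 0" by (rule \<epsilon>(1))
    fix J assume "open_interval J \<and> J \<subseteq> I \<inter> ball x0 \<epsilon> \<and> \<not> g constant_on J"
    then have J: "open_interval J" "J \<subseteq> I \<inter> ball x0 \<epsilon>" "\<not> g constant_on J" by simp_all
    have JB: "J \<subseteq> {x0 - \<epsilon><..<x0 + \<epsilon>}" using J(2) by (simp add: ball_eq_greaterThanLessThan)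
    have gJ: "g ` J \<subseteq> {..<x0 - \<epsilon>}"
    proof (intro image_subsetI)
      fix x assume "x \<in> J"
      then have "x \<in> {x0 - \<epsilon><..<x0 + \<epsilon>}" using JB by blast
      then have "dist x x0 < s" using \<epsilon>(4) by (auto simp: dist_real_def)
      then have "g x < g x0 + \<delta>" using s(2)[of x] by (simp add: dist_real_def)
      also have "\<dots> = x0 - \<delta>" by (simp add: \<delta>_def field_simps)
      finally show "g x \<in> {..<x0 - \<epsilon>}" using \<epsilon>(3) by simp
    qed
    have sub: "smooth1 {x0 - r<..<x0 + r} f" if "smooth1 I f" for f
      by (rule smooth1_subset[OF that]) (rule order_trans[OF _ r(2)], auto simp: cball_eq_atLeastAtMost)
    have "\<exists>\<rho>. lin_smooth_solution J a1 a2 a3 a4 g \<rho> \<and> (\<forall>t<x0 - \<epsilon>. \<rho> t = t ^ k)" for k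
    proof -
      have in_cball: "x \<in> cball x0 r" if "x \<in> {x0 - \<epsilon>..x0 + \<epsilon>}" for x
        using that \<epsilon>(2) r(1) by (auto simp: cball_eq_atLeastAtMost)
      have len: "x0 + \<epsilon> - (x0 - \<epsilon>) = 2 * \<epsilon>" by simp
      show ?thesis
        by (rule local_monomial_solution[OF smooth[THEN sub], where a = "x0 - \<epsilon>" and
              b = "x0 + \<epsilon>" and P = P and Q = Q and J = J and k = k])
          (use \<epsilon> r(1) PQ in_cball small JB gJ in \<open>auto simp: len\<close>)
    qed
    then obtain \<rho> where \<rho>: "\<And>k. lin_smooth_solution J a1 a2 a3 a4 g (\<rho> k)"
      "\<And>k t. t < x0 - \<epsilon> \<Longrightarrow> \<rho> k t = t ^ k"
      by metis
    have "continuous_on J g"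
      using J(2) by (intro continuous_on_subset[OF smooth1_continuous_on[OF smooth(5)]]) auto
    then have "infinite (g ` J)"
      using J open_interval_connected by (intro infinite_image_connected)
    then show "infinite_dimensional_on ((J \<union> g ` J) \<times> UNIV) (lin_algebra J a1 a2 a3 a4 g)"
    proof (rule infinite_dimensional_onI[where v = "\<lambda>k. vf_X (\<rho> k)" and y = 0, rotated])
      show "vf_X (\<rho> k) (s, 0) = (0, s ^ k)" if "s \<in> g ` J" for k s
        using subsetD[OF gJ that] \<rho>(2) by (simp add: vf_X_def)
    qed (use \<rho>(1) vf_X_in_lin_algebra in auto)
  qed
qed

text \<open>A nonconstant smooth \<open>g\<close> may be constant on subintervals, so a centre has
  to be chosen. Any point with nonzero derivative works, and one exists because a vanishing
  derivative on the connected set \<open>I\<close> would make \<open>g\<close> constant.\<close>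

lemma exists_locally_nonconstant_point:
  fixes g :: "real \<Rightarrow> real"
  assumes I: "open_interval I" and g: "smooth1 I g" and "\<not> g constant_on I"
  shows "\<exists>x0\<in>I. \<forall>J. open J \<and> x0 \<in> J \<longrightarrow> \<not> g constant_on J"
proof -
  have "\<exists>x0\<in>I. deriv g x0 \<noteq> 0"
  proof (rule ccontr)
    assume "\<not> (\<exists>x0\<in>I. deriv g x0 \<noteq> 0)"
    then have "(g has_real_derivative 0) (at x)" if "x \<in> I" for x
      using smooth1_differentiable[OF g that] that
      by (metis DERIV_deriv_iff_real_differentiable)
    then have "g constant_on I"
      using I open_interval_connected[OF I]
      by (intro has_field_derivative_0_imp_constant_on) (auto simp: open_interval_def)
    with assms(3) show False ..
  qed
  then obtain x0 where x0: "x0 \<in> I" "deriv g x0 \<noteq> 0" by blast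
  have "\<not> g constant_on J" if "open J" "x0 \<in> J" for J
  proof
    assume "g constant_on J"
    then obtain c where "\<And>x. x \<in> J \<Longrightarrow> g x = c" by (auto simp: constant_on_def)
    with that have "deriv g x0 = deriv (\<lambda>_. c) x0" by (intro deriv_cong_open)
    with x0(2) show False by simp
  qed
  with x0(1) show ?thesis by blast
qed

text \<open>The local dimension claim excludes intervals on which \<open>g\<close> is constant:
  there the delayed terms see \<open>\<rho>\<close> and its derivative at a single point only. The
  last conjunct provides an interval where the algebra is infinite-dimensional.\<close>

theorem theorem4p2:
  fixes I :: "real set" and a1 a2 a3 a4 g :: "real \<Rightarrow> real"
  assumes I: "open_interval I"
    and smooth: "smooth1 I a1" "smooth1 I a2" "smooth1 I a3" "smooth1 I a4" "smooth1 I g"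
    and delayed_terms: "\<exists>x\<in>I. (a2 x)\<^sup>2 + (a4 x)\<^sup>2 \<noteq> 0"
    and delay: "\<And>x. x \<in> I \<Longrightarrow> g x < x"
    and g_nonconst: "\<not> g constant_on I"
  shows
    "(\<forall>J. open_interval J \<and> J \<subseteq> I \<longrightarrow>
        (\<forall>\<rho>. lin_solution J a1 a2 a3 a4 g \<rho> \<longrightarrow>
           dods_admits J (lin_rhs a1 a2 a3 a4) (lin_delay g) (vf_X \<rho>)) \<and>
        (\<forall>\<rho>. lin_smooth_solution J a1 a2 a3 a4 g \<rho> \<longrightarrow>
           lie_point_symmetry J (lin_rhs a1 a2 a3 a4) (lin_delay g) (vf_X \<rho>)) \<and>
        lie_point_symmetry J (lin_rhs a1 a2 a3 a4) (lin_delay g) vf_Y \<and>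
        vf_lie_algebra (lin_algebra J a1 a2 a3 a4 g) \<and>
        (\<forall>V\<in>lin_algebra J a1 a2 a3 a4 g.
           lie_point_symmetry J (lin_rhs a1 a2 a3 a4) (lin_delay g) V)) \<and>
     (\<forall>x0\<in>I. \<exists>\<epsilon>>0. \<forall>J. open_interval J \<and> x0 \<in> J \<and> J \<subseteq> I \<inter> ball x0 \<epsilon> \<and> \<not> g constant_on J \<longrightarrow>
        infinite_dimensional_on ((J \<union> g ` J) \<times> UNIV) (lin_algebra J a1 a2 a3 a4 g)) \<and>
     (\<exists>J. open_interval J \<and> J \<subseteq> I \<and>
        infinite_dimensional_on ((J \<union> g ` J) \<times> UNIV) (lin_algebra J a1 a2 a3 a4 g))"
proof -
  have sym: "\<forall>\<rho>. lin_solution J a1 a2 a3 a4 g \<rho> \<longrightarrow>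
        dods_admits J (lin_rhs a1 a2 a3 a4) (lin_delay g) (vf_X \<rho>)"
      "\<forall>\<rho>. lin_smooth_solution J a1 a2 a3 a4 g \<rho> \<longrightarrow>
        lie_point_symmetry J (lin_rhs a1 a2 a3 a4) (lin_delay g) (vf_X \<rho>)"
      "lie_point_symmetry J (lin_rhs a1 a2 a3 a4) (lin_delay g) vf_Y"
    for J
    by (auto simp: vf_X_eq_affine vf_Y_eq_affine intro: dods_admits_affine
        lie_point_symmetry_affine lin_smooth_solution_const_0)
  have algebra: "vf_lie_algebra (lin_algebra J a1 a2 a3 a4 g)"
      "\<forall>V\<in>lin_algebra J a1 a2 a3 a4 g.
        lie_point_symmetry J (lin_rhs a1 a2 a3 a4) (lin_delay g) V"
    if "open_interval J" for J
  proof -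
    have J: "open J" using that by (simp add: open_interval_def)
    then show "vf_lie_algebra (lin_algebra J a1 a2 a3 a4 g)"
      by (rule vf_lie_algebra_lin_algebra)
    show "\<forall>V\<in>lin_algebra J a1 a2 a3 a4 g.
        lie_point_symmetry J (lin_rhs a1 a2 a3 a4) (lin_delay g) V"
    proof
      fix V assume "V \<in> lin_algebra J a1 a2 a3 a4 g"
      with J obtain \<rho> c where "V = vf_affine \<rho> c" "lin_smooth_solution J a1 a2 a3 a4 g \<rho>"
        by (rule lin_algebra_elim)
      then show "lie_point_symmetry J (lin_rhs a1 a2 a3 a4) (lin_delay g) V"
        by (simp add: lie_point_symmetry_affine)
    qed
  qed
  note near = infinite_dimensional_near_point[OF I smooth _ delay]
  have ex: "\<exists>J. open_interval J \<and> J \<subseteq> I \<and>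
        infinite_dimensional_on ((J \<union> g ` J) \<times> UNIV) (lin_algebra J a1 a2 a3 a4 g)"
  proof -
    obtain x0 where x0: "x0 \<in> I" "\<forall>J. open J \<and> x0 \<in> J \<longrightarrow> \<not> g constant_on J"
      using exists_locally_nonconstant_point[OF I smooth(5) g_nonconst] by blast
    obtain \<epsilon> where \<epsilon>: "\<epsilon> > 0" "\<And>J. open_interval J \<Longrightarrow> J \<subseteq> I \<inter> ball x0 \<epsilon> \<Longrightarrow> \<not> g constant_on J \<Longrightarrow>
        infinite_dimensional_on ((J \<union> g ` J) \<times> UNIV) (lin_algebra J a1 a2 a3 a4 g)"
      using near[OF x0(1) x0(1)] by blast
    \<comment> \<open>Since \<open>g\<close> is nonconstant on every open set around
      \<open>x0\<close>, shrinking to the ball of radius \<open>\<epsilon>\<close> keeps it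
      nonconstant.\<close>
    have J: "open_interval (I \<inter> ball x0 \<epsilon>)"
      using I x0(1) \<epsilon>(1)
      by (auto simp: open_interval_def is_interval_ball_real intro: is_interval_Int)
    then have "\<not> g constant_on (I \<inter> ball x0 \<epsilon>)"
      using x0 \<epsilon>(1) by (auto simp: open_interval_def)
    with \<epsilon>(2)[OF J] J show ?thesis by blast
  qed
  show ?thesis
  proof (intro conjI ballI)
    show "\<exists>\<epsilon>>0. \<forall>J. open_interval J \<and> x0 \<in> J \<and> J \<subseteq> I \<inter> ball x0 \<epsilon> \<and> \<not> g constant_on J \<longrightarrow>
        infinite_dimensional_on ((J \<union> g ` J) \<times> UNIV) (lin_algebra J a1 a2 a3 a4 g)"
      if x0: "x0 \<in> I" for x0
    proof -
      obtain \<epsilon> where \<epsilon>: "\<epsilon> > 0" "\<And>J. open_interval J \<Longrightarrow> J \<subseteq> I \<inter> ball x0 \<epsilon> \<Longrightarrow> \<not> g constant_on J \<Longrightarrow>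
          infinite_dimensional_on ((J \<union> g ` J) \<times> UNIV) (lin_algebra J a1 a2 a3 a4 g)"
        using near[OF x0 x0] by blast
      show ?thesis
        by (intro exI[of _ \<epsilon>] conjI allI impI \<epsilon>; elim conjE; assumption)
    qed
  qed (use sym algebra ex in simp_all)
qed

end
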